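(* Let $\Sigma=\begin{bmatrix}A&B\\C&D\end{bmatrix}$ be a linear system. Then the following holds. (1) If the internal reciprocal transform $\Sigma_-$ of $\Sigma$ exists, it is impedance passive if and only if $\Sigma$ is impedance passive. (2) If the external reciprocal transform $\Sigma_f$ of $\Sigma$ exists, it is impedance passive if and only if $\Sigma$ is impedance passive. Both claims remain true if the word "passive" is replaced by "conservative".
   Context: All matrices and signals are real and finite-dimensional; norms and inner products are Euclidean. A linear system $\Sigma=\begin{bmatrix}A&B\\C&D\end{bmatrix}$ is the quadruple of matrices in $x'(t)=Ax(t)+Bu(t)$, $y(t)=Cx(t)+Du(t)$, $t\in I$ ($I\subset\mathbb R$ an interval, signals sufficiently smooth for classical solvability), where $u$ and $y$ have the same dimension. $\Sigma$ is impedance passive if all functions $u,x,y$ satisfying these equations satisfy $\frac{d}{dt}\|x(t)\|^2\le2\langle u(t),y(t)\rangle$ for all $t\in I$, and impedance conservative if this always holds as an equality. The internal reciprocal transform of $\Sigma$ exists if $A$ is invertible, and is $\Sigma_-=\begin{bmatrix}A^{-1}&A^{-1}B\\-CA^{-1}&D-CA^{-1}B\end{bmatrix}$. The external reciprocal transform of $\Sigma$ exists if $D$ is invertible, and is $\Sigma_f=\begin{bmatrix}A-BD^{-1}C&BD^{-1}\\-D^{-1}C&D^{-1}\end{bmatrix}$. *)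

theory Defs
  imports "HOL-Analysis.Analysis"
begin

text \<open>State space \<open>real ^ 'n\<close>; inputs and outputs both in \<open>real ^ 'm\<close>.\<close>

record ('n, 'm) linear_system =
  sys_A :: "real ^ 'n ^ 'n"
  sys_B :: "real ^ 'm ^ 'n"
  sys_C :: "real ^ 'n ^ 'm"
  sys_D :: "real ^ 'm ^ 'm"

text \<open>Classical trajectories on the time set \<open>I\<close>: the input is continuous, hence \<open>x\<close> is
  continuously differentiable and \<open>y\<close> is continuous.  Derivatives are taken within \<open>I\<close>, so they are
  one-sided at end points belonging to \<open>I\<close>; they are unique when \<open>I\<close> is a nondegenerate interval.\<close>

definition trajectory ::
  "real set \<Rightarrow> ('n::finite, 'm::finite) linear_system \<Rightarrow>
    (real \<Rightarrow> real ^ 'm) \<Rightarrow> (real \<Rightarrow> real ^ 'n) \<Rightarrow> (real \<Rightarrow> real ^ 'm) \<Rightarrow> bool" where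
  "trajectory I \<Sigma> u x y \<longleftrightarrow>
     continuous_on I u \<and>
     (\<forall>t\<in>I. (x has_vector_derivative (sys_A \<Sigma> *v x t + sys_B \<Sigma> *v u t)) (at t within I) \<and>
            y t = sys_C \<Sigma> *v x t + sys_D \<Sigma> *v u t)"

definition impedance_passive :: "real set \<Rightarrow> ('n::finite, 'm::finite) linear_system \<Rightarrow> bool" where
  "impedance_passive I \<Sigma> \<longleftrightarrow>
     (\<forall>u x y. trajectory I \<Sigma> u x y \<longrightarrow>
        (\<forall>t\<in>I. \<exists>d. ((\<lambda>s. (norm (x s))\<^sup>2) has_real_derivative d) (at t within I) \<and>
                  d \<le> 2 * (u t \<bullet> y t)))"

definition impedance_conservative :: "real set \<Rightarrow> ('n::finite, 'm::finite) linear_system \<Rightarrow> bool" where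
  "impedance_conservative I \<Sigma> \<longleftrightarrow>
     (\<forall>u x y. trajectory I \<Sigma> u x y \<longrightarrow>
        (\<forall>t\<in>I. \<exists>d. ((\<lambda>s. (norm (x s))\<^sup>2) has_real_derivative d) (at t within I) \<and>
                  d = 2 * (u t \<bullet> y t)))"

text \<open>The two transforms are meaningful only if \<open>sys_A \<Sigma>\<close>, respectively \<open>sys_D \<Sigma>\<close>, is invertible;
  otherwise \<open>matrix_inv\<close> is unspecified.\<close>

definition internal_reciprocal ::
  "('n::finite, 'm::finite) linear_system \<Rightarrow> ('n, 'm) linear_system" where
  "internal_reciprocal \<Sigma> =
     \<lparr> sys_A = matrix_inv (sys_A \<Sigma>),
       sys_B = matrix_inv (sys_A \<Sigma>) ** sys_B \<Sigma>,
       sys_C = - (sys_C \<Sigma> ** matrix_inv (sys_A \<Sigma>)),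
       sys_D = sys_D \<Sigma> - sys_C \<Sigma> ** matrix_inv (sys_A \<Sigma>) ** sys_B \<Sigma> \<rparr>"

definition external_reciprocal ::
  "('n::finite, 'm::finite) linear_system \<Rightarrow> ('n, 'm) linear_system" where
  "external_reciprocal \<Sigma> =
     \<lparr> sys_A = sys_A \<Sigma> - sys_B \<Sigma> ** matrix_inv (sys_D \<Sigma>) ** sys_C \<Sigma>,
       sys_B = sys_B \<Sigma> ** matrix_inv (sys_D \<Sigma>),
       sys_C = - (matrix_inv (sys_D \<Sigma>) ** sys_C \<Sigma>),
       sys_D = matrix_inv (sys_D \<Sigma>) \<rparr>"

end

theory Submission
  imports Defs
begin

text \<open>
  Along a trajectory the chain rule gives \<open>d/dt (norm x)\<^sup>2 = 2 * (x \<bullet> (A x + B u))\<close>, so the supplied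
  power exceeds the growth of the stored energy by twice the quadratic form
  \<open>u \<bullet> (C x + D u) - x \<bullet> (A x + B u)\<close> of the current values of \<open>x\<close> and \<open>u\<close>.  Hence passivity and
  conservativity say that this form is nonnegative, respectively zero, at all points \<open>(x, u)\<close> that
  trajectories visit.  Every point is visited at an interior time of \<open>I\<close>, because with a constant
  input the state equation is an affine differential equation with constant coefficients and
  so has a solution through any prescribed state (\<open>affine_ode_solution\<close>).  Both properties therefore
  depend only on the set of values of the form
  (\<open>impedance_passive_iff\<close>, \<open>impedance_conservative_iff\<close>).

  A reciprocal transform only relabels the signals.  The internal one replaces \<open>(x, u)\<close> by
  \<open>(A x + B u, - u)\<close>, which interchanges the two factors of \<open>x \<bullet> (A x + B u)\<close>; the external one
  replaces \<open>u\<close> by \<open>C x + D u\<close>, which interchanges the two factors of \<open>u \<bullet> (C x + D u)\<close>.  The form of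
  the transformed system at the relabelled point is the form of the original system
  at the original point, and the relabelling is onto when \<open>A\<close>, respectively \<open>D\<close>, is invertible.  So
  the forms of the two systems have the same values.
\<close>

section \<open>Affine differential equations with constant coefficients\<close>

text \<open>The value of the solution at the initial time and those of its successive derivatives, as
  obtained by differentiating \<open>x' = A x + b\<close> repeatedly: the constant \<open>b\<close> contributes only to the
  first derivative.  Division by factorials gives the Taylor coefficients.\<close>

fun affine_ode_deriv :: "real ^ 'n ^ 'n \<Rightarrow> real ^ 'n \<Rightarrow> real ^ 'n \<Rightarrow> nat \<Rightarrow> real ^ 'n" where
  "affine_ode_deriv A b x0 0 = x0"
| "affine_ode_deriv A b x0 (Suc k) = A *v affine_ode_deriv A b x0 k + (if k = 0 then b else 0)"

text \<open>Geometric growth of the derivatives lets the exponential series dominate the Taylor series,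
  so that the latter converges at all times.\<close>

lemma affine_ode_deriv_bound:
  fixes A :: "real ^ 'n::finite ^ 'n"
  obtains K M where "\<And>k. norm (affine_ode_deriv A b x0 k) \<le> M * K ^ k"
proof -
  obtain K0 where K0: "\<And>v. norm (A *v v) \<le> norm v * K0"
    using bounded_linear.bounded[OF matrix_vector_mul_bounded_linear] by blast
  \<comment> \<open>With \<open>K \<ge> 1\<close> the first step may absorb the inhomogeneity \<open>b\<close> into \<open>M\<close>.\<close>
  define K where "K = max 1 K0"
  define M where "M = norm x0 + norm b"
  have K: "1 \<le> K" "norm (A *v v) \<le> K * norm v" for v
  proof -
    show "1 \<le> K" by (simp add: K_def)
    have "norm v * K0 \<le> norm v * K" by (intro mult_left_mono) (auto simp: K_def)
    then show "norm (A *v v) \<le> K * norm v" using K0[of v] by (simp add: mult.commute)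
  qed
  have "norm (affine_ode_deriv A b x0 k) \<le> M * K ^ k" for k
  proof (induction k)
    case 0
    then show ?case by (simp add: M_def)
  next
    case (Suc k)
    show ?case
    proof (cases "k = 0")
      case True
      have "norm (A *v x0 + b) \<le> K * norm x0 + norm b"
        using norm_triangle_ineq[of "A *v x0" b] K(2)[of x0] by linarith
      also have "\<dots> \<le> K * norm x0 + K * norm b"
        using mult_right_mono[OF K(1), of "norm b"] by simp
      finally show ?thesis using True by (simp add: M_def algebra_simps)
    next
      case False
      have "norm (A *v affine_ode_deriv A b x0 k) \<le> K * (M * K ^ k)"
        using K(2)[of "affine_ode_deriv A b x0 k"] mult_left_mono[OF Suc.IH, of K] K(1)
        by linarith
      then show ?thesis using False by (simp add: algebra_simps)
    qed
  qed
  then show ?thesis using that by blast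
qed

lemma has_vector_derivative_vec_lambda:
  fixes f :: "'i::finite \<Rightarrow> real \<Rightarrow> real"
  assumes "\<And>i. (f i has_real_derivative d i) F"
  shows "((\<lambda>t. \<chi> i. f i t) has_vector_derivative (\<chi> i. d i)) F"
proof -
  have expand: "(\<chi> i. g i) = (\<Sum>i\<in>UNIV. g i *\<^sub>R (axis i 1 :: real ^ 'i))" for g :: "'i \<Rightarrow> real"
    by (simp add: vec_eq_iff axis_def if_distrib cong: if_cong)
  have "((\<lambda>t. \<Sum>i\<in>UNIV. f i t *\<^sub>R (axis i 1 :: real ^ 'i)) has_vector_derivative
      (\<Sum>i\<in>UNIV. d i *\<^sub>R axis i 1)) F"
    unfolding has_vector_derivative_def
    by (rule derivative_eq_intros assms[unfolded has_field_derivative_def] refl)+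
       (simp add: fun_eq_iff scaleR_sum_right mult.commute)
  then show ?thesis by (simp add: expand)
qed

text \<open>The solution is the sum of its Taylor series, taken componentwise so that the theorem on
  termwise differentiation of real power series applies.\<close>

lemma affine_ode_solution:
  fixes A :: "real ^ 'n::finite ^ 'n"
  obtains x where "x t0 = x0" "\<And>t. (x has_vector_derivative (A *v x t + b)) (at t)"
proof -
  define w where "w = affine_ode_deriv A b x0"
  define c where "c i k = w k $ i / fact k" for i k
  define p where "p i s = (\<Sum>k. c i k * s ^ k)" for i and s :: real
  obtain K M where bound: "\<And>k. norm (w k) \<le> M * K ^ k"
    unfolding w_def using affine_ode_deriv_bound[of A b x0] by blast
  have sm: "summable (\<lambda>k. c i k * s ^ k)" for i s
  proof (rule summable_comparison_test')
    show "summable (\<lambda>k. M * ((K * \<bar>s\<bar>) ^ k / fact k))"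
      using summable_exp_generic[of "K * \<bar>s\<bar>"] by (intro summable_mult) (simp add: field_simps)
    fix k
    have "\<bar>w k $ i\<bar> \<le> M * K ^ k" using component_le_norm_cart[of "w k" i] bound[of k] by linarith
    then have "\<bar>w k $ i\<bar> * \<bar>s\<bar> ^ k / fact k \<le> M * K ^ k * \<bar>s\<bar> ^ k / fact k"
      by (intro divide_right_mono mult_right_mono) auto
    then show "norm (c i k * s ^ k) \<le> M * ((K * \<bar>s\<bar>) ^ k / fact k)"
      by (simp add: c_def abs_mult power_abs power_mult_distrib mult.assoc)
  qed
  \<comment> \<open>Differentiation shifts the derivatives by one, and their recursion is the differential equation
    in terms of coefficients.\<close>
  have dc: "diffs (c i) k = (\<Sum>j\<in>UNIV. A $ i $ j * c j k) + (if k = 0 then b $ i else 0)" for i k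
  proof -
    have "diffs (c i) k = w (Suc k) $ i / fact k"
      by (simp add: diffs_def c_def divide_simps)
    also have "\<dots> = (\<Sum>j\<in>UNIV. A $ i $ j * c j k) + (if k = 0 then b $ i else 0)"
      by (simp add: w_def c_def matrix_vector_mult_def sum_divide_distrib)
    finally show ?thesis .
  qed
  have dp: "(\<Sum>k. diffs (c i) k * s ^ k) = (\<Sum>j\<in>UNIV. A $ i $ j * p j s) + b $ i" for i s
  proof -
    have "(\<lambda>k. c j k * s ^ k) sums p j s" for j
      using sm by (simp add: p_def summable_sums)
    then have "(\<lambda>k. \<Sum>j\<in>UNIV. A $ i $ j * (c j k * s ^ k)) sums (\<Sum>j\<in>UNIV. A $ i $ j * p j s)"
      by (intro sums_sum sums_mult)
    from sums_add[OF this sums_single[of 0 "\<lambda>_. b $ i"]]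
    have "(\<lambda>k. diffs (c i) k * s ^ k) sums ((\<Sum>j\<in>UNIV. A $ i $ j * p j s) + b $ i)"
      by (rule back_subst[of "\<lambda>f. f sums _"])
         (auto simp: fun_eq_iff dc algebra_simps sum_distrib_left)
    then show ?thesis by (rule sums_unique[symmetric])
  qed
  define x where "x t = (\<chi> i. p i (t - t0))" for t
  have "(p i has_real_derivative (A *v (\<chi> j. p j s) + b) $ i) (at s)" for i s
    using termdiffs_strong_converges_everywhere[OF sm, of i s]
    by (simp add: p_def[abs_def, symmetric] dp matrix_vector_mult_def)
       (simp add: p_def[abs_def])
  then have "((\<lambda>t. p i (t - t0)) has_real_derivative (A *v x t + b) $ i) (at t)" for i t
    unfolding x_def
    by (rule DERIV_chain'[where g = "p i" and f = "\<lambda>t. t - t0" and D = 1, simplified, rotated])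
       (auto intro!: derivative_eq_intros)
  then have "((\<lambda>t. \<chi> i. p i (t - t0)) has_vector_derivative (\<chi> i. (A *v x t + b) $ i)) (at t)" for t
    by (intro has_vector_derivative_vec_lambda)
  then have "(x has_vector_derivative (A *v x t + b)) (at t)" for t
    by (simp only: vec_nth_inverse x_def[abs_def])
  moreover have "x t0 = x0"
    using powser_zero[of "c _"] by (simp add: x_def p_def vec_eq_iff) (simp add: c_def w_def)
  ultimately show ?thesis using that by blast
qed

section \<open>The power balance as a quadratic form\<close>

text \<open>Half the amount by which \<open>2 * (u \<bullet> y)\<close> exceeds the derivative of \<open>(norm x)\<^sup>2\<close> along trajectories.\<close>

definition dissipation ::
  "('n::finite, 'm::finite) linear_system \<Rightarrow> real ^ 'n \<Rightarrow> real ^ 'm \<Rightarrow> real" where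
  "dissipation \<Sigma> x u =
     u \<bullet> (sys_C \<Sigma> *v x + sys_D \<Sigma> *v u) - x \<bullet> (sys_A \<Sigma> *v x + sys_B \<Sigma> *v u)"

lemma trajectory_energy_derivative:
  assumes "trajectory I \<Sigma> u x y" "t \<in> I"
  shows "((\<lambda>s. (norm (x s))\<^sup>2) has_real_derivative
           2 * (u t \<bullet> y t) - 2 * dissipation \<Sigma> (x t) (u t)) (at t within I)"
proof -
  let ?v = "sys_A \<Sigma> *v x t + sys_B \<Sigma> *v u t"
  have "(x has_vector_derivative ?v) (at t within I)" and y: "y t = sys_C \<Sigma> *v x t + sys_D \<Sigma> *v u t"
    using assms by (auto simp: trajectory_def)
  then have "((\<lambda>s. x s \<bullet> x s) has_real_derivative x t \<bullet> ?v + ?v \<bullet> x t) (at t within I)"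
    unfolding has_vector_derivative_def has_field_derivative_def
    by (auto intro!: derivative_eq_intros simp: fun_eq_iff algebra_simps)
  then show ?thesis
    by (simp add: power2_norm_eq_inner dissipation_def y inner_commute algebra_simps)
qed

text \<open>A constant input suffices, since only the values at one time are prescribed.\<close>

lemma trajectory_through:
  obtains u x y where "trajectory I \<Sigma> u x y" "x t0 = x0" "u t0 = u0"
proof -
  obtain x where "x t0 = x0"
    "\<And>t. (x has_vector_derivative (sys_A \<Sigma> *v x t + sys_B \<Sigma> *v u0)) (at t)"
    using affine_ode_solution[of t0 x0 "sys_A \<Sigma>" "sys_B \<Sigma> *v u0"] by blast
  then have "trajectory I \<Sigma> (\<lambda>_. u0) x (\<lambda>t. sys_C \<Sigma> *v x t + sys_D \<Sigma> *v u0)"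
    by (auto simp: trajectory_def intro: has_vector_derivative_at_within)
  then show ?thesis using that \<open>x t0 = x0\<close> by blast
qed

text \<open>Passivity and conservativity are the cases \<open>\<le>\<close> and \<open>=\<close> of one statement about a relation
  between the energy derivative and the supplied power.  The time is chosen in the interior of
  \<open>I\<close> because the derivative within \<open>I\<close> is certainly unique there.\<close>

lemma power_balance_iff:
  fixes \<Sigma> :: "('n::finite, 'm::finite) linear_system"
  assumes "interior I \<noteq> {}"
  shows "(\<forall>u x y. trajectory I \<Sigma> u x y \<longrightarrow>
            (\<forall>t\<in>I. \<exists>d. ((\<lambda>s. (norm (x s))\<^sup>2) has_real_derivative d) (at t within I) \<and>
                       R d (2 * (u t \<bullet> y t))))
       \<longleftrightarrow> (\<forall>x u. R (2 * (u \<bullet> (sys_C \<Sigma> *v x + sys_D \<Sigma> *v u)) - 2 * dissipation \<Sigma> x u)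
                  (2 * (u \<bullet> (sys_C \<Sigma> *v x + sys_D \<Sigma> *v u))))"
    (is "?traj \<longleftrightarrow> ?form")
proof
  assume ?traj
  show ?form
  proof (intro allI)
    fix x0 u0
    obtain t0 where t0: "t0 \<in> interior I" using assms by blast
    then have "t0 \<in> I" using interior_subset by blast
    obtain u x y where tr: "trajectory I \<Sigma> u x y" and init: "x t0 = x0" "u t0 = u0"
      by (rule trajectory_through)
    obtain d where d: "((\<lambda>s. (norm (x s))\<^sup>2) has_real_derivative d) (at t0 within I)"
      and R: "R d (2 * (u t0 \<bullet> y t0))"
      using \<open>?traj\<close> tr \<open>t0 \<in> I\<close> by blast
    have "d = 2 * (u t0 \<bullet> y t0) - 2 * dissipation \<Sigma> (x t0) (u t0)"
      using d trajectory_energy_derivative[OF tr \<open>t0 \<in> I\<close>]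
      unfolding at_within_interior[OF t0] by (rule DERIV_unique)
    moreover have "y t0 = sys_C \<Sigma> *v x t0 + sys_D \<Sigma> *v u t0"
      using tr \<open>t0 \<in> I\<close> by (simp add: trajectory_def)
    ultimately show "R (2 * (u0 \<bullet> (sys_C \<Sigma> *v x0 + sys_D \<Sigma> *v u0)) - 2 * dissipation \<Sigma> x0 u0)
        (2 * (u0 \<bullet> (sys_C \<Sigma> *v x0 + sys_D \<Sigma> *v u0)))"
      using R init by simp
  qed
next
  assume form: ?form
  show ?traj
  proof (intro allI impI ballI exI conjI)
    fix u x y t
    assume tr: "trajectory I \<Sigma> u x y" and "t \<in> I"
    show "((\<lambda>s. (norm (x s))\<^sup>2) has_real_derivative
        2 * (u t \<bullet> y t) - 2 * dissipation \<Sigma> (x t) (u t)) (at t within I)"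
      by (rule trajectory_energy_derivative) fact+
    show "R (2 * (u t \<bullet> y t) - 2 * dissipation \<Sigma> (x t) (u t)) (2 * (u t \<bullet> y t))"
      using form tr \<open>t \<in> I\<close> by (simp add: trajectory_def)
  qed
qed

lemma impedance_passive_iff:
  assumes "interior I \<noteq> {}"
  shows "impedance_passive I \<Sigma> \<longleftrightarrow> (\<forall>x u. dissipation \<Sigma> x u \<ge> 0)"
  unfolding impedance_passive_def power_balance_iff[OF assms] by simp

lemma impedance_conservative_iff:
  assumes "interior I \<noteq> {}"
  shows "impedance_conservative I \<Sigma> \<longleftrightarrow> (\<forall>x u. dissipation \<Sigma> x u = 0)"
  unfolding impedance_conservative_def power_balance_iff[OF assms] by simp

section \<open>The reciprocal transforms preserve the values of the form\<close>

lemma matrix_inv_vector_mult: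
  fixes A :: "real ^ 'n::finite ^ 'n"
  assumes "invertible A"
  shows "matrix_inv A *v (A *v v) = v" "A *v (matrix_inv A *v v) = v"
proof -
  have "A ** matrix_inv A = mat 1 \<and> matrix_inv A ** A = mat 1"
    using assms unfolding invertible_def matrix_inv_def by (rule someI_ex)
  then show "matrix_inv A *v (A *v v) = v" "A *v (matrix_inv A *v v) = v"
    by (simp_all add: matrix_vector_mul_assoc)
qed

lemma matrix_vector_mult_neg:
  fixes A :: "real ^ 'n::finite ^ 'm::finite"
  shows "A *v (- v) = - (A *v v)" "(- A) *v v = - (A *v v)"
  by (simp_all add: matrix_vector_mult_def vec_eq_iff sum_negf)

text \<open>With \<open>z = A x + B u\<close> the transformed state equation at \<open>(z, - u)\<close> has right-hand side
  \<open>A\<inverse> (z - B u) = x\<close>, and the transformed output is \<open>- (C x + D u)\<close>.  So \<open>x \<bullet> z\<close> keeps its value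
  with the factors exchanged, and the two signs in the supplied power cancel.\<close>

lemma dissipation_internal_reciprocal:
  assumes "invertible (sys_A \<Sigma>)"
  shows "dissipation (internal_reciprocal \<Sigma>) (sys_A \<Sigma> *v x + sys_B \<Sigma> *v u) (- u)
       = dissipation \<Sigma> x u"
  by (simp add: dissipation_def internal_reciprocal_def matrix_vector_mult_neg
      matrix_vector_mul_assoc[symmetric] matrix_inv_vector_mult[OF assms]
      inner_commute algebra_simps)

text \<open>With \<open>y = C x + D u\<close> the transformed output at \<open>(x, y)\<close> is \<open>D\<inverse> (y - C x) = u\<close>, and the
  right-hand side of the state equation is still \<open>A x + B u\<close>.\<close>

lemma dissipation_external_reciprocal:
  assumes "invertible (sys_D \<Sigma>)"
  shows "dissipation (external_reciprocal \<Sigma>) x (sys_C \<Sigma> *v x + sys_D \<Sigma> *v u) = dissipation \<Sigma> x u"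
  by (simp add: dissipation_def external_reciprocal_def matrix_vector_mult_neg
      matrix_vector_mul_assoc[symmetric] matrix_inv_vector_mult[OF assms]
      inner_commute algebra_simps)

lemma all_dissipation_internal_reciprocal_iff:
  fixes \<Sigma> :: "('n::finite, 'm::finite) linear_system"
  assumes inv: "invertible (sys_A \<Sigma>)"
  shows "(\<forall>x u. P (dissipation (internal_reciprocal \<Sigma>) x u)) \<longleftrightarrow> (\<forall>x u. P (dissipation \<Sigma> x u))"
proof -
  have "dissipation (internal_reciprocal \<Sigma>) x u =
      dissipation \<Sigma> (matrix_inv (sys_A \<Sigma>) *v (x + sys_B \<Sigma> *v u)) (- u)" for x u
    using dissipation_internal_reciprocal[OF inv,
        of "matrix_inv (sys_A \<Sigma>) *v (x + sys_B \<Sigma> *v u)" "- u"]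
    by (simp add: matrix_inv_vector_mult[OF inv] matrix_vector_mult_neg)
  then show ?thesis
    using dissipation_internal_reciprocal[OF inv] by metis
qed

lemma all_dissipation_external_reciprocal_iff:
  fixes \<Sigma> :: "('n::finite, 'm::finite) linear_system"
  assumes inv: "invertible (sys_D \<Sigma>)"
  shows "(\<forall>x u. P (dissipation (external_reciprocal \<Sigma>) x u)) \<longleftrightarrow> (\<forall>x u. P (dissipation \<Sigma> x u))"
proof -
  have "dissipation (external_reciprocal \<Sigma>) x u =
      dissipation \<Sigma> x (matrix_inv (sys_D \<Sigma>) *v (u - sys_C \<Sigma> *v x))" for x u
    using dissipation_external_reciprocal[OF inv,
        of x "matrix_inv (sys_D \<Sigma>) *v (u - sys_C \<Sigma> *v x)"]
    by (simp add: matrix_inv_vector_mult[OF inv])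
  then show ?thesis
    using dissipation_external_reciprocal[OF inv] by metis
qed

theorem proposition13:
  fixes \<Sigma> :: "('n::finite, 'm::finite) linear_system"
    and I :: "real set"
  assumes "is_interval I" and "interior I \<noteq> {}"
  shows "(invertible (sys_A \<Sigma>) \<longrightarrow>
            (impedance_passive I (internal_reciprocal \<Sigma>) \<longleftrightarrow> impedance_passive I \<Sigma>))
       \<and> (invertible (sys_D \<Sigma>) \<longrightarrow>
            (impedance_passive I (external_reciprocal \<Sigma>) \<longleftrightarrow> impedance_passive I \<Sigma>))
       \<and> (invertible (sys_A \<Sigma>) \<longrightarrow>
            (impedance_conservative I (internal_reciprocal \<Sigma>) \<longleftrightarrow> impedance_conservative I \<Sigma>))
       \<and> (invertible (sys_D \<Sigma>) \<longrightarrow>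
            (impedance_conservative I (external_reciprocal \<Sigma>) \<longleftrightarrow> impedance_conservative I \<Sigma>))"
  unfolding impedance_passive_iff[OF assms(2)] impedance_conservative_iff[OF assms(2)]
  by (intro conjI impI all_dissipation_internal_reciprocal_iff all_dissipation_external_reciprocal_iff)

end
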